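(* Let $f$ be a Kneser function of order $d\ge1$. If $$\lim_{r\to 0} \frac{f(r)}{r^s}=C$$ for some constants $s,C\in(0,\infty)$, then $$\lim_{r\to 0} \frac{f'_+(r)}{s r^{s-1}}=\lim_{r\to 0} \frac{f'_-(r)}{s r^{s-1}}=C .$$
   Context: A function $f:(0,\infty)\to(0,\infty)$ is called a Kneser function of order $d\ge1$ if for all $0<a\le b<\infty$ and all $\lambda\ge1$, $$f(\lambda b)-f(\lambda a)\le\lambda^d\,(f(b)-f(a)).$$ $f'_+$ and $f'_-$ denote the right and left derivatives of $f$; it is known (Stach\'o) that for a Kneser function both exist at every $r>0$, with $f'_+(r)\le f'_-(r)$. Limits are taken as $r\searrow0$. *)

theory Defs
  imports Complex_Main
begin

text \<open>
  A function \<open>(0,\<infinity>) \<rightarrow> (0,\<infinity>)\<close> is represented by a total function on the reals; only its values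
  at positive arguments are constrained or used. The order \<open>d\<close> is an arbitrary real number.
\<close>

definition Kneser_function :: "real \<Rightarrow> (real \<Rightarrow> real) \<Rightarrow> bool" where
  "Kneser_function d f \<longleftrightarrow>
     (\<forall>r>0. f r > 0) \<and>
     (\<forall>a b l. 0 < a \<longrightarrow> a \<le> b \<longrightarrow> 1 \<le> l \<longrightarrow>
        f (l * b) - f (l * a) \<le> l powr d * (f b - f a))"

text \<open>
  One-sided derivatives, unspecified where they do not exist. For a Kneser function of order
  \<open>d \<ge> 1\<close> both exist at every \<open>r > 0\<close>.
\<close>

definition right_deriv :: "(real \<Rightarrow> real) \<Rightarrow> real \<Rightarrow> real" where
  "right_deriv f r = (THE D. (f has_real_derivative D) (at_right r))"

definition left_deriv :: "(real \<Rightarrow> real) \<Rightarrow> real \<Rightarrow> real" where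
  "left_deriv f r = (THE D. (f has_real_derivative D) (at_left r))"

end

theory Submission
  imports Defs
begin

text \<open>
  The idea is to work in the logarithmic variable \<open>t = ln r\<close>. For \<open>g t = f (exp t)\<close> the Kneser
  inequality says that \<open>exp (- d t) (g (t + h) - g t)\<close> is nonincreasing in \<open>t\<close> for every step
  \<open>h \<ge> 0\<close>: the increments of \<open>g\<close> grow at most at rate \<open>d\<close> under translation. Since \<open>f\<close> is
  positive, it must be nondecreasing, because one decrease would repeat along a geometric
  progression until \<open>f\<close> became negative; hence all increments of \<open>g\<close> are nonnegative.

  Cutting an increment of length \<open>h\<close> into pieces of length \<open>x\<close> and comparing all the pieces with
  the one adjacent to \<open>t\<close> shows that, up to factors tending to 1, the right difference quotient at
  \<open>t\<close> can only grow and the left one can only decrease as the step shrinks. So both quotients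
  converge, the first to a supremum \<open>p\<close> and the second to an infimum \<open>q\<close>
  (lemma \<open>one_sided_quotients_converge\<close>), and for every fixed \<open>h > 0\<close>
  \<open>exp (- d h) (g (t + h) - g t) / h \<le> p \<le> q \<le> exp (d h) (g t - g (t - h)) / h\<close>.
  Back in the variable \<open>r\<close> these limits are \<open>r\<close> times the one-sided derivatives of \<open>f\<close>
  (lemma \<open>Kneser_one_sided_derivs\<close>).

  It remains to divide by \<open>s r\<^sup>s\<close>. As \<open>r \<rightarrow> 0\<close> with \<open>h\<close> fixed, the hypothesis on \<open>f\<close> makes the outer
  bounds tend to \<open>C exp (- d h) (exp (s h) - 1) / (s h)\<close> and
  \<open>C exp (d h) (1 - exp (- s h)) / (s h)\<close>, and both of these tend to \<open>C\<close> as \<open>h \<rightarrow> 0\<close>. Taking the two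
  limits in this order squeezes both normalised derivatives to \<open>C\<close>.
\<close>

section \<open>Monotonicity of Kneser functions\<close>

text \<open>
  If \<open>f b < f a\<close> with \<open>b = q a\<close> and \<open>q \<ge> 1\<close>, dilation by \<open>q\<^sup>k\<close> turns this drop into a drop at least
  as large from \<open>q\<^sup>k a\<close> to \<open>q\<close> times this point. The drops add up along the progression, which
  contradicts positivity.
\<close>
lemma Kneser_function_mono:
  assumes "Kneser_function d f" and "d \<ge> 0" and "0 < a" and "a \<le> b"
  shows "f a \<le> f b"
proof (rule ccontr)
  assume "\<not> f a \<le> f b"
  then have \<delta>: "f a - f b > 0" by simp
  define q where "q = b / a"
  have q: "q \<ge> 1" "b = q * a" using assms(3,4) by (auto simp: q_def field_simps)
  have drop: "f (q ^ k * a) \<le> f a - real k * (f a - f b)" for k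
  proof (induction k)
    case (Suc k)
    have qk: "q ^ k \<ge> 1" using q(1) by simp
    have "f (q ^ k * b) - f (q ^ k * a) \<le> (q ^ k) powr d * (f b - f a)"
      using assms(1,3,4) qk unfolding Kneser_function_def by blast
    also have "\<dots> \<le> 1 * (f b - f a)"
      using \<delta> qk assms(2) by (intro mult_right_mono_neg) (auto simp: ge_one_powr_ge_zero)
    finally show ?case using Suc by (simp add: q(2) algebra_simps)
  qed simp
  obtain k :: nat where "f a < real k * (f a - f b)"
    using reals_Archimedean3[OF \<delta>] by blast
  then have "f (q ^ k * a) < 0" using drop[of k] by linarith
  moreover have "f (q ^ k * a) > 0"
    using assms(1,3) q(1) unfolding Kneser_function_def by simp
  ultimately show False by simp
qed

section \<open>One-sided difference quotients of increments with controlled growth\<close>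

context
  fixes g :: "real \<Rightarrow> real" and d :: real
  assumes d_nonneg: "d \<ge> 0"
    and g_mono: "\<And>x y. x \<le> y \<Longrightarrow> g x \<le> g y"
    and shift: "\<And>t h u. h \<ge> 0 \<Longrightarrow> u \<ge> 0 \<Longrightarrow> g (t + h + u) - g (t + u) \<le> exp (d * u) * (g (t + h) - g t)"
begin

text \<open>
  The \<open>k\<close>-th of \<open>n\<close> consecutive steps is the first one translated by \<open>k x \<le> n x\<close>, so it exceeds the
  first by a factor of at most \<open>exp (d n x)\<close>.
\<close>
lemma forward_steps:
  assumes "x \<ge> 0"
  shows "g (t + real n * x) - g t \<le> real n * exp (d * (real n * x)) * (g (t + x) - g t)"
proof (induction n)
  case (Suc n)
  have inc: "g (t + x) - g t \<ge> 0" using g_mono[of t "t + x"] assms by simp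
  have e: "exp (d * (real n * x)) \<le> exp (d * (real (Suc n) * x))"
    using d_nonneg assms by (simp add: mult_left_mono mult_right_mono)
  have "g (t + real (Suc n) * x) - g (t + real n * x) \<le> exp (d * (real n * x)) * (g (t + x) - g t)"
    using shift[of x "real n * x" t] assms by (simp add: algebra_simps)
  also have "\<dots> \<le> exp (d * (real (Suc n) * x)) * (g (t + x) - g t)"
    by (intro mult_right_mono e inc)
  finally have 1: "g (t + real (Suc n) * x) - g (t + real n * x) \<le> \<dots>" .
  have "real n * exp (d * (real n * x)) * (g (t + x) - g t)
      \<le> real n * exp (d * (real (Suc n) * x)) * (g (t + x) - g t)"
    by (intro mult_right_mono mult_left_mono e inc) simp
  with Suc 1 show ?case by (simp add: algebra_simps)
qed simp

text \<open>
  The mirror image: the step that ends at \<open>t\<close> is a translate of each of the \<open>n\<close> steps to its left,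
  so \<open>n\<close> copies of it are bounded by the sum of these.
\<close>
lemma backward_steps:
  assumes "x \<ge> 0"
  shows "real n * (g t - g (t - x)) \<le> exp (d * (real n * x)) * (g t - g (t - real n * x))"
proof (induction n)
  case (Suc n)
  have inc: "g t - g (t - real n * x) \<ge> 0" using g_mono[of "t - real n * x" t] assms by simp
  have inc': "g (t - real n * x) - g (t - real (Suc n) * x) \<ge> 0"
    using g_mono[of "t - real (Suc n) * x" "t - real n * x"] assms by (simp add: algebra_simps)
  have e: "exp (d * (real n * x)) \<le> exp (d * (real (Suc n) * x))"
    using d_nonneg assms by (simp add: mult_left_mono mult_right_mono)
  have "g t - g (t - x) \<le> exp (d * (real n * x)) * (g (t - real n * x) - g (t - real (Suc n) * x))"
    using shift[of x "real n * x" "t - real (Suc n) * x"] assms by (simp add: algebra_simps)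
  also have "\<dots> \<le> exp (d * (real (Suc n) * x)) * (g (t - real n * x) - g (t - real (Suc n) * x))"
    by (intro mult_right_mono e inc')
  finally have 1: "g t - g (t - x) \<le> \<dots>" .
  have "exp (d * (real n * x)) * (g t - g (t - real n * x))
      \<le> exp (d * (real (Suc n) * x)) * (g t - g (t - real n * x))"
    by (intro mult_right_mono e inc)
  with Suc 1 have "real (Suc n) * (g t - g (t - x)) \<le>
     exp (d * (real (Suc n) * x)) * (g t - g (t - real n * x)) +
     exp (d * (real (Suc n) * x)) * (g (t - real n * x) - g (t - real (Suc n) * x))"
    by (simp add: algebra_simps)
  then show ?case by (simp only: distrib_left[symmetric]) simp
qed simp

text \<open>
  The next two estimates replace the number of steps by a real ratio. On the right, steps of
  length \<open>x\<close> have to cover \<open>[t, t + h]\<close>, so \<open>h / x\<close> is rounded up; on the left they have to stay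
  inside \<open>[t - h, t]\<close>, so it is rounded down. Both rounding errors disappear as \<open>x \<rightarrow> 0\<close>.
\<close>
lemma right_quotient_le:
  assumes "0 < x" and "0 < h"
  shows "(g (t + h) - g t) / h \<le> (1 + x / h) * exp (d * (h + x)) * ((g (t + x) - g t) / x)"
proof -
  define n where "n = nat \<lceil>h / x\<rceil>"
  have n: "h / x \<le> real n" "real n \<le> h / x + 1"
    using assms by (auto simp: n_def real_nat_ceiling_ge)
  have nx: "h \<le> real n * x" "real n * x \<le> h + x"
    using n assms by (auto simp: field_simps)
  have inc: "g (t + x) - g t \<ge> 0" using g_mono[of t "t + x"] assms by simp
  have "g (t + h) - g t \<le> g (t + real n * x) - g t" using nx(1) by (simp add: g_mono)
  also have "\<dots> \<le> real n * exp (d * (real n * x)) * (g (t + x) - g t)"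
    using forward_steps assms(1) by simp
  also have "\<dots> \<le> (h / x + 1) * exp (d * (h + x)) * (g (t + x) - g t)"
    using n nx d_nonneg inc assms by (intro mult_right_mono mult_mono) (auto simp: mult_left_mono)
  finally have "(g (t + h) - g t) / h \<le> (h / x + 1) * exp (d * (h + x)) * (g (t + x) - g t) / h"
    using assms(2) by (simp add: divide_right_mono)
  also have "\<dots> = (1 + x / h) * exp (d * (h + x)) * ((g (t + x) - g t) / x)"
    using assms by (simp add: field_simps)
  finally show ?thesis .
qed

lemma left_quotient_le:
  assumes "0 < x" and "0 < h"
  shows "(1 - x / h) * ((g t - g (t - x)) / x) \<le> exp (d * h) * ((g t - g (t - h)) / h)"
proof -
  define n where "n = nat \<lfloor>h / x\<rfloor>"
  have n: "real n \<le> h / x" "h / x - 1 \<le> real n"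
    using assms by (auto simp: n_def)
  have nx: "real n * x \<le> h" using n assms by (auto simp: field_simps)
  have inc: "g t - g (t - x) \<ge> 0" using g_mono[of "t - x" t] assms by simp
  have "(h / x - 1) * (g t - g (t - x)) \<le> real n * (g t - g (t - x))"
    by (intro mult_right_mono n inc)
  also have "\<dots> \<le> exp (d * (real n * x)) * (g t - g (t - real n * x))"
    using backward_steps assms(1) by simp
  also have "\<dots> \<le> exp (d * h) * (g t - g (t - h))"
    using nx d_nonneg assms by (intro mult_mono) (auto simp: mult_left_mono g_mono)
  finally have "(h / x - 1) * (g t - g (t - x)) / h \<le> exp (d * h) * (g t - g (t - h)) / h"
    using assms(2) by (simp add: divide_right_mono)
  moreover have "(h / x - 1) * (g t - g (t - x)) / h = (1 - x / h) * ((g t - g (t - x)) / x)"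
    using assms by (simp add: field_simps)
  ultimately show ?thesis by simp
qed

lemma right_quotient_le_left_quotient:
  assumes "0 < x"
  shows "(g (t + x) - g t) / x \<le> exp (d * x) * ((g t - g (t - x)) / x)"
  using shift[of x x "t - x"] assms by (simp add: divide_right_mono)

text \<open>
  With \<open>w h = exp (d h) L h\<close> for the left quotient \<open>L\<close>, the estimate \<open>(1 - x / h) L x \<le> w h\<close> bounds
  the upper limit of \<open>L\<close> by every \<open>w h\<close>, while \<open>L x\<close> is at least \<open>exp (- d x)\<close> times the infimum
  of \<open>w\<close>. Hence \<open>L\<close> converges to that infimum, which exists because \<open>g\<close> is nondecreasing.
\<close>
lemma left_quotient_converges:
  obtains p where "((\<lambda>x. (g t - g (t - x)) / x) \<longlongrightarrow> p) (at_right 0)"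
    and "\<And>h. h > 0 \<Longrightarrow> p \<le> exp (d * h) * ((g t - g (t - h)) / h)"
proof -
  define L where "L x = (g t - g (t - x)) / x" for x
  define w where "w h = exp (d * h) * L h" for h
  define p where "p = (INF h\<in>{0<..}. w h)"
  have w_nonneg: "w h \<ge> 0" if "h > 0" for h
    using that by (simp add: w_def L_def g_mono)
  have bdd: "bdd_below (w ` {0<..})"
    using w_nonneg by (intro bdd_belowI[of _ 0]) auto
  have p_le: "p \<le> w h" if "h > 0" for h
    unfolding p_def using that bdd by (intro cINF_lower) auto
  have "(L \<longlongrightarrow> p) (at_right 0)"
  proof (rule order_tendstoI)
    fix a assume "a < p"
    have "((\<lambda>x. exp (- (d * x)) * p) \<longlongrightarrow> exp (- (d * 0)) * p) (at_right 0)"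
      by (intro tendsto_intros)
    then have "\<forall>\<^sub>F x in at_right 0. a < exp (- (d * x)) * p"
      using \<open>a < p\<close> by (intro order_tendstoD(1)) auto
    then show "\<forall>\<^sub>F x in at_right 0. a < L x"
      using eventually_at_right_less[of "0::real"]
    proof eventually_elim
      case (elim x)
      have "exp (- (d * x)) * p \<le> exp (- (d * x)) * w x"
        using p_le[of x] elim by (intro mult_left_mono) auto
      also have "\<dots> = L x" by (simp add: w_def exp_minus field_simps)
      finally show ?case using elim by simp
    qed
  next
    fix a assume "p < a"
    then obtain h where h: "h > 0" "w h < a"
      unfolding p_def using cInf_lessD[of "w ` {0<..}" a] by auto
    have "((\<lambda>x. w h / (1 - x / h)) \<longlongrightarrow> w h / (1 - 0 / h)) (at_right 0)"
      using h by (intro tendsto_intros) auto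
    then have "\<forall>\<^sub>F x in at_right 0. w h / (1 - x / h) < a"
      using h by (intro order_tendstoD(2)) auto
    moreover have "\<forall>\<^sub>F x in at_right 0. x < h"
      using h by (auto simp: eventually_at_right_field)
    ultimately show "\<forall>\<^sub>F x in at_right 0. L x < a"
      using eventually_at_right_less[of "0::real"]
    proof eventually_elim
      case (elim x)
      have "(1 - x / h) * L x \<le> w h"
        using left_quotient_le[of x h t] elim h by (simp add: L_def w_def)
      then have "L x \<le> w h / (1 - x / h)" using elim h by (simp add: field_simps)
      then show ?case using elim by simp
    qed
  qed
  then show thesis using that p_le unfolding L_def w_def by blast
qed

text \<open>
  On the right the same argument runs with \<open>w h = exp (- d h) R h\<close> and its supremum. Here
  boundedness is not automatic: it comes from comparing the right quotient with the left one,
  whose limit \<open>q\<close> then bounds every \<open>w h\<close>. The same bound gives \<open>p \<le> q\<close>.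
\<close>
lemma one_sided_quotients_converge:
  obtains p q where "((\<lambda>x. (g (t + x) - g t) / x) \<longlongrightarrow> p) (at_right 0)"
    and "((\<lambda>x. (g t - g (t - x)) / x) \<longlongrightarrow> q) (at_right 0)"
    and "\<And>h. h > 0 \<Longrightarrow> exp (- (d * h)) * ((g (t + h) - g t) / h) \<le> p"
    and "p \<le> q"
    and "\<And>h. h > 0 \<Longrightarrow> q \<le> exp (d * h) * ((g t - g (t - h)) / h)"
proof -
  obtain q where q: "((\<lambda>x. (g t - g (t - x)) / x) \<longlongrightarrow> q) (at_right 0)"
    "\<And>h. h > 0 \<Longrightarrow> q \<le> exp (d * h) * ((g t - g (t - h)) / h)"
    using left_quotient_converges by blast
  define R where "R x = (g (t + x) - g t) / x" for x
  define w where "w h = exp (- (d * h)) * R h" for h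
  define p where "p = (SUP h\<in>{0<..}. w h)"
  have w_le: "w h \<le> (1 + x / h) * exp (d * x) * R x" if "x > 0" "h > 0" for x h
  proof -
    have "w h \<le> exp (- (d * h)) * ((1 + x / h) * exp (d * (h + x)) * R x)"
      unfolding w_def R_def using right_quotient_le[OF that] by (intro mult_left_mono) auto
    also have "\<dots> = (1 + x / h) * (exp (- (d * h)) * exp (d * (h + x))) * R x"
      by (simp only: mult_ac)
    also have "exp (- (d * h)) * exp (d * (h + x)) = exp (d * x)"
      by (simp add: algebra_simps flip: exp_add)
    finally show ?thesis .
  qed
  have w_le_q: "w h \<le> q" if "h > 0" for h
  proof (rule tendsto_lowerbound)
    have "((\<lambda>x. (1 + x / h) * exp (d * x) * (exp (d * x) * ((g t - g (t - x)) / x)))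
      \<longlongrightarrow> (1 + 0 / h) * exp (d * 0) * (exp (d * 0) * q)) (at_right 0)"
      using that by (intro tendsto_intros q(1)) auto
    then show "((\<lambda>x. (1 + x / h) * exp (d * x) * (exp (d * x) * ((g t - g (t - x)) / x)))
      \<longlongrightarrow> q) (at_right 0)" by simp
    show "\<forall>\<^sub>F x in at_right 0.
       w h \<le> (1 + x / h) * exp (d * x) * (exp (d * x) * ((g t - g (t - x)) / x))"
      using eventually_at_right_less[of "0::real"]
    proof eventually_elim
      case (elim x)
      have "(1 + x / h) * exp (d * x) * R x
         \<le> (1 + x / h) * exp (d * x) * (exp (d * x) * ((g t - g (t - x)) / x))"
        unfolding R_def using right_quotient_le_left_quotient[OF elim] elim that
        by (intro mult_left_mono) auto
      with w_le[OF elim that] show ?case by linarith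
    qed
  qed simp
  have bdd: "bdd_above (w ` {0<..})"
    using w_le_q by (intro bdd_aboveI[of _ q]) auto
  have le_p: "w h \<le> p" if "h > 0" for h
    unfolding p_def using that bdd by (intro cSUP_upper) auto
  have "p \<le> q" unfolding p_def using w_le_q by (intro cSUP_least) auto
  moreover have "(R \<longlongrightarrow> p) (at_right 0)"
  proof (rule order_tendstoI)
    fix a assume "p < a"
    have "((\<lambda>x. exp (d * x) * p) \<longlongrightarrow> exp (d * 0) * p) (at_right 0)"
      by (intro tendsto_intros)
    then have "\<forall>\<^sub>F x in at_right 0. exp (d * x) * p < a"
      using \<open>p < a\<close> by (intro order_tendstoD(2)) auto
    then show "\<forall>\<^sub>F x in at_right 0. R x < a"
      using eventually_at_right_less[of "0::real"]
    proof eventually_elim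
      case (elim x)
      have "R x = exp (d * x) * w x" by (simp add: w_def exp_minus field_simps)
      also have "\<dots> \<le> exp (d * x) * p"
        using le_p[of x] elim by (intro mult_left_mono) auto
      finally show ?case using elim by simp
    qed
  next
    fix a assume "a < p"
    then obtain h where h: "h > 0" "a < w h"
      unfolding p_def using less_cSupD[of "w ` {0<..}" a] by auto
    have "((\<lambda>x. w h / ((1 + x / h) * exp (d * x))) \<longlongrightarrow> w h / ((1 + 0 / h) * exp (d * 0))) (at_right 0)"
      using h by (intro tendsto_intros) auto
    then have "\<forall>\<^sub>F x in at_right 0. a < w h / ((1 + x / h) * exp (d * x))"
      using h by (intro order_tendstoD(1)) auto
    then show "\<forall>\<^sub>F x in at_right 0. a < R x"
      using eventually_at_right_less[of "0::real"]
    proof eventually_elim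
      case (elim x)
      have "(1 + x / h) * exp (d * x) > 0" using elim h by (simp add: add_pos_pos)
      then have "w h / ((1 + x / h) * exp (d * x)) \<le> R x"
        using w_le[of x h] elim h by (simp add: pos_divide_le_eq mult.commute)
      then show ?case using elim by simp
    qed
  qed
  ultimately show thesis using that q le_p unfolding R_def w_def by blast
qed

end

section \<open>One-sided derivatives of Kneser functions\<close>

lemma right_deriv_eqI:
  assumes "(f has_real_derivative D) (at_right r)"
  shows "right_deriv f r = D"
  unfolding right_deriv_def
proof (rule the_equality)
  fix E assume "(f has_real_derivative E) (at_right r)"
  with assms show "E = D"
    unfolding has_field_derivative_iff
    using tendsto_unique[OF trivial_limit_at_right_real] by blast
qed (fact assms)

lemma left_deriv_eqI:
  assumes "(f has_real_derivative D) (at_left r)"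
  shows "left_deriv f r = D"
  unfolding left_deriv_def
proof (rule the_equality)
  fix E assume "(f has_real_derivative E) (at_left r)"
  with assms show "E = D"
    unfolding has_field_derivative_iff
    using tendsto_unique[OF trivial_limit_at_left_real] by blast
qed (fact assms)

lemma has_right_derivative_quotient_iff:
  fixes g :: "real \<Rightarrow> real"
  shows "(g has_real_derivative p) (at_right t) \<longleftrightarrow>
    ((\<lambda>x. (g (t + x) - g t) / x) \<longlongrightarrow> p) (at_right 0)"
  unfolding has_field_derivative_iff filterlim_at_right_to_0[of _ _ t] by (simp add: add.commute)

lemma has_left_derivative_quotient_iff:
  fixes g :: "real \<Rightarrow> real"
  shows "(g has_real_derivative p) (at_left t) \<longleftrightarrow>
    ((\<lambda>x. (g t - g (t - x)) / x) \<longlongrightarrow> p) (at_right 0)"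
proof -
  have "at_left t = filtermap (\<lambda>x. t - x) (at_right 0)"
    unfolding at_left_minus[of t] at_right_to_0[of "- t"] by (simp add: filtermap_filtermap)
  moreover have "(g (t - x) - g t) / (t - x - t) = (g t - g (t - x)) / x" for x
    by (cases "x = 0") (simp_all add: field_simps)
  ultimately show ?thesis
    unfolding has_field_derivative_iff by (simp add: filterlim_filtermap)
qed

text \<open>
  The bounds for \<open>g t = f (exp t)\<close> at \<open>t = ln r\<close>; the factor \<open>r\<close> is the derivative of \<open>exp\<close> at \<open>ln r\<close>.
  The proof supplies existence of the one-sided derivatives, without which these inequalities
  would speak about unspecified values.
\<close>
lemma Kneser_one_sided_derivs:
  assumes "Kneser_function d f" and "d \<ge> 0" and "r > 0"
  shows "\<And>h. h > 0 \<Longrightarrow> exp (- (d * h)) * ((f (r * exp h) - f r) / h) \<le> r * right_deriv f r"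
    and "r * right_deriv f r \<le> r * left_deriv f r"
    and "\<And>h. h > 0 \<Longrightarrow> r * left_deriv f r \<le> exp (d * h) * ((f r - f (r * exp (- h))) / h)"
proof -
  define g where "g t = f (exp t)" for t
  have mono: "g x \<le> g y" if "x \<le> y" for x y
    unfolding g_def using that by (intro Kneser_function_mono[OF assms(1,2)]) auto
  have shift: "g (t + h + u) - g (t + u) \<le> exp (d * u) * (g (t + h) - g t)"
    if "h \<ge> 0" "u \<ge> 0" for t h u
  proof -
    have "f (exp u * exp (t + h)) - f (exp u * exp t) \<le> exp u powr d * (f (exp (t + h)) - f (exp t))"
      using assms(1) that unfolding Kneser_function_def by simp
    then show ?thesis by (simp add: g_def powr_def exp_add mult_ac)
  qed
  obtain p q where pq: "((\<lambda>x. (g (ln r + x) - g (ln r)) / x) \<longlongrightarrow> p) (at_right 0)"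
     "((\<lambda>x. (g (ln r) - g (ln r - x)) / x) \<longlongrightarrow> q) (at_right 0)"
     "\<And>h. h > 0 \<Longrightarrow> exp (- (d * h)) * ((g (ln r + h) - g (ln r)) / h) \<le> p"
     "p \<le> q"
     "\<And>h. h > 0 \<Longrightarrow> q \<le> exp (d * h) * ((g (ln r) - g (ln r - h)) / h)"
    using one_sided_quotients_converge[OF assms(2) mono shift] by blast
  have ln: "(ln has_real_derivative 1 / r) (at r within S)" for S
    using assms(3) DERIV_ln_divide by (blast intro: has_field_derivative_at_within)
  have near_right: "\<forall>\<^sub>F x in at_right r. f x = (g \<circ> ln) x"
    using assms(3) by (auto simp: g_def eventually_at_right_field intro!: exI[of _ "r + 1"])
  have near_left: "\<forall>\<^sub>F x in at_left r. f x = (g \<circ> ln) x"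
    using assms(3) by (auto simp: g_def eventually_at_left_field intro!: exI[of _ 0])
  have "((g \<circ> ln) has_real_derivative p * (1 / r)) (at_right r)"
    using pq(1)[folded has_right_derivative_quotient_iff] assms(3)
    by (intro DERIV_image_chain ln) (auto intro: DERIV_subset)
  then have "(f has_real_derivative p / r) (at_right r)"
    using near_right assms(3) by (subst has_field_derivative_cong_eventually[where g = "g \<circ> ln"]) (auto simp: g_def)
  then have R: "right_deriv f r = p / r" by (rule right_deriv_eqI)
  \<comment> \<open>Unlike on the right, the points have to be kept positive for \<open>ln\<close> to map them to the left of \<open>ln r\<close>.\<close>
  have "((g \<circ> ln) has_real_derivative q * (1 / r)) (at r within {0<..<r})"
    using pq(2)[folded has_left_derivative_quotient_iff]
    by (intro DERIV_image_chain ln) (auto intro: DERIV_subset)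
  moreover have "at r within {0<..<r} = at_left r"
    using assms(3) by (intro at_within_nhd[of _ "{0<..}"]) auto
  ultimately have "((g \<circ> ln) has_real_derivative q * (1 / r)) (at_left r)" by simp
  then have "(f has_real_derivative q / r) (at_left r)"
    using near_left assms(3) by (subst has_field_derivative_cong_eventually[where g = "g \<circ> ln"]) (auto simp: g_def)
  then have L: "left_deriv f r = q / r" by (rule left_deriv_eqI)
  show "r * right_deriv f r \<le> r * left_deriv f r"
    using pq(4) assms(3) by (simp add: R L)
  fix h :: real assume "h > 0"
  moreover have "exp (ln r + h) = r * exp h" "exp (ln r - h) = r * exp (- h)"
    using assms(3) exp_add[of "ln r" h] exp_add[of "ln r" "- h"] by simp_all
  ultimately show "exp (- (d * h)) * ((f (r * exp h) - f r) / h) \<le> r * right_deriv f r"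
    "r * left_deriv f r \<le> exp (d * h) * ((f r - f (r * exp (- h))) / h)"
    using pq(3)[of h] pq(5)[of h] assms(3)
    by (simp_all add: R L g_def)
qed

section \<open>Passing to the limit at zero\<close>

lemma tendsto_scaled_powr_quotient:
  fixes f :: "real \<Rightarrow> real"
  assumes "((\<lambda>r. f r / r powr s) \<longlongrightarrow> C) (at_right 0)"
  shows "((\<lambda>r. f (r * exp h) / r powr s) \<longlongrightarrow> C * exp (s * h)) (at_right 0)"
proof -
  have "filterlim (\<lambda>r. r * exp h) (at_right 0) (at_right (0::real))"
    unfolding filterlim_at
    by (auto intro!: tendsto_eq_intros eventually_at_rightI[of 0 1])
  then have "((\<lambda>r. f (r * exp h) / (r * exp h) powr s * exp (s * h)) \<longlongrightarrow> C * exp (s * h)) (at_right 0)"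
    by (intro tendsto_intros filterlim_compose[OF assms])
  then show ?thesis
  proof (rule Lim_transform_eventually)
    show "\<forall>\<^sub>F r in at_right 0. f (r * exp h) / (r * exp h) powr s * exp (s * h) = f (r * exp h) / r powr s"
      using eventually_at_right_less[of "0::real"]
    proof eventually_elim
      case (elim r)
      then have "(r * exp h) powr s = r powr s * exp (s * h)"
        by (simp add: powr_mult) (simp add: powr_def)
      then show ?case by simp
    qed
  qed
qed

lemma tendsto_exp_quotient:
  "((\<lambda>h::real. (exp (c * h) - 1) / h) \<longlongrightarrow> c) (at_right 0)"
proof -
  have "((\<lambda>x. exp (c * x)) has_real_derivative c) (at_right 0)"
    by (auto intro!: derivative_eq_intros)
  then show ?thesis by (simp add: has_right_derivative_quotient_iff)
qed

text \<open>
  A squeeze in which the bounds depend on a parameter \<open>h\<close> and close up only in the limit of \<open>h\<close>: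
  given a margin, one \<open>h\<close> with \<open>A h\<close> and \<open>B h\<close> within it is chosen first and then kept fixed, so no
  uniformity in \<open>h\<close> is required.
\<close>
lemma tendsto_if_squeezed_by_iterated_limits:
  fixes F :: "'a \<Rightarrow> real" and l u :: "'b \<Rightarrow> 'a \<Rightarrow> real"
  assumes "G \<noteq> bot"
    and "\<forall>\<^sub>F h in G. (l h \<longlongrightarrow> A h) H" and "(A \<longlongrightarrow> C) G"
    and "\<forall>\<^sub>F h in G. (u h \<longlongrightarrow> B h) H" and "(B \<longlongrightarrow> C) G"
    and "\<forall>\<^sub>F h in G. \<forall>\<^sub>F r in H. l h r \<le> F r \<and> F r \<le> u h r"
  shows "(F \<longlongrightarrow> C) H"
proof (rule order_tendstoI)
  fix a assume "a < C"
  with assms(3) have "\<forall>\<^sub>F h in G. a < A h" by (rule order_tendstoD)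
  then have "\<forall>\<^sub>F h in G. \<forall>\<^sub>F r in H. a < F r"
    using assms(2,6)
  proof eventually_elim
    case (elim h)
    show ?case
      using order_tendstoD(1)[OF elim(2,1)] elim(3) by eventually_elim auto
  qed
  then show "\<forall>\<^sub>F r in H. a < F r" using assms(1) by simp
next
  fix a assume "C < a"
  with assms(5) have "\<forall>\<^sub>F h in G. B h < a" by (rule order_tendstoD)
  then have "\<forall>\<^sub>F h in G. \<forall>\<^sub>F r in H. F r < a"
    using assms(4,6)
  proof eventually_elim
    case (elim h)
    show ?case
      using order_tendstoD(2)[OF elim(2,1)] elim(3) by eventually_elim auto
  qed
  then show "\<forall>\<^sub>F r in H. F r < a" using assms(1) by simp
qed

theorem proposition2p3:
  fixes f :: "real \<Rightarrow> real" and d s C :: real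
  assumes "d \<ge> 1"
    and "Kneser_function d f"
    and "s > 0" and "C > 0"
    and "((\<lambda>r. f r / r powr s) \<longlongrightarrow> C) (at_right 0)"
  shows "((\<lambda>r. right_deriv f r / (s * r powr (s - 1))) \<longlongrightarrow> C) (at_right 0) \<and>
         ((\<lambda>r. left_deriv f r / (s * r powr (s - 1))) \<longlongrightarrow> C) (at_right 0)"
proof -
  \<comment> \<open>The bounds of \<open>Kneser_one_sided_derivs\<close> divided by \<open>s r\<^sup>s\<close>, and their limits \<open>A\<close>, \<open>B\<close> as \<open>r \<rightarrow> 0\<close>.\<close>
  define l where "l h r = exp (- (d * h)) * ((f (r * exp h) / r powr s - f r / r powr s) / h) / s" for h r
  define u where "u h r = exp (d * h) * ((f r / r powr s - f (r * exp (- h)) / r powr s) / h) / s" for h r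
  define A where "A h = exp (- (d * h)) * (C * ((exp (s * h) - 1) / h)) / s" for h
  define B where "B h = exp (d * h) * (- C * ((exp (- s * h) - 1) / h)) / s" for h
  have l: "(l h \<longlongrightarrow> A h) (at_right 0)" if "h > 0" for h
  proof -
    have "(l h \<longlongrightarrow> exp (- (d * h)) * ((C * exp (s * h) - C) / h) / s) (at_right 0)"
      unfolding l_def using that assms(3)
      by (intro tendsto_intros tendsto_scaled_powr_quotient[OF assms(5)] assms(5)) auto
    then show ?thesis by (simp add: A_def algebra_simps)
  qed
  have u: "(u h \<longlongrightarrow> B h) (at_right 0)" if "h > 0" for h
  proof -
    have "(u h \<longlongrightarrow> exp (d * h) * ((C - C * exp (s * - h)) / h) / s) (at_right 0)"
      unfolding u_def using that assms(3)
      by (intro tendsto_intros tendsto_scaled_powr_quotient[OF assms(5)] assms(5)) auto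
    moreover have "C - C * exp (s * - h) = - C * (exp (- s * h) - 1)" by (simp add: algebra_simps)
    ultimately show ?thesis by (simp add: B_def)
  qed
  have "(A \<longlongrightarrow> exp (- (d * 0)) * (C * s) / s) (at_right 0)"
    unfolding A_def using assms(3) by (intro tendsto_intros tendsto_exp_quotient) auto
  then have A: "(A \<longlongrightarrow> C) (at_right 0)" using assms(3) by simp
  have "(B \<longlongrightarrow> exp (d * 0) * (- C * (- s)) / s) (at_right 0)"
    unfolding B_def using assms(3) by (intro tendsto_intros tendsto_exp_quotient) auto
  then have B: "(B \<longlongrightarrow> C) (at_right 0)" using assms(3) by simp
  have squeeze: "(F \<longlongrightarrow> C) (at_right 0)"
    if "\<And>h r. h > 0 \<Longrightarrow> r > 0 \<Longrightarrow> l h r \<le> F r \<and> F r \<le> u h r" for F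
    using that
    by (intro tendsto_if_squeezed_by_iterated_limits[OF _ _ A _ B])
      (auto intro!: eventually_mono[OF eventually_at_right_less[of "0::real"]] l u)
  have scale: "D / (s * r powr (s - 1)) = r * D / r powr s / s" if "r > 0" for r D :: real
    using that assms(3) by (simp add: powr_diff field_simps)
  have "l h r \<le> right_deriv f r / (s * r powr (s - 1)) \<and>
        right_deriv f r / (s * r powr (s - 1)) \<le> left_deriv f r / (s * r powr (s - 1)) \<and>
        left_deriv f r / (s * r powr (s - 1)) \<le> u h r"
    if "h > 0" "r > 0" for h r
  proof -
    have d: "d \<ge> 0" using assms(1) by simp
    note * = Kneser_one_sided_derivs[OF assms(2) d \<open>r > 0\<close>]
    have "l h r = exp (- (d * h)) * ((f (r * exp h) - f r) / h) / r powr s / s"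
      "u h r = exp (d * h) * ((f r - f (r * exp (- h))) / h) / r powr s / s"
      using that assms(3) by (simp_all only: l_def u_def diff_divide_distrib[symmetric] times_divide_eq_right divide_divide_eq_left mult_ac)
    then show ?thesis unfolding scale[OF \<open>r > 0\<close>]
      using *(1)[OF \<open>h > 0\<close>] *(2) *(3)[OF \<open>h > 0\<close>] assms(3)
      by (simp only:) (intro conjI divide_right_mono; simp)
  qed
  then show ?thesis by (intro conjI squeeze) (meson order_trans)+
qed

end
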